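(* There is no unitary $U\in\mathcal{SU}(4)$ that achieves perfect quantum-phase synchronization for the set of all pure product states of two qubits. That is, there is no $U\in\mathcal{SU}(4)$ such that $F(\rho,U)=1$ for every pure product state $\rho=|\psi_1\rangle\langle\psi_1|\otimes|\psi_2\rangle\langle\psi_2|$ of two qubits for which $F(\rho,U)$ is defined.
   Context: The Bloch vector of a qubit density matrix $\rho$ is $\mathbf n=\operatorname{tr}(\boldsymbol\sigma\rho)=(n_x,n_y,n_z)$, where $\boldsymbol\sigma=(\sigma_x,\sigma_y,\sigma_z)$ is the vector of Pauli matrices in a fixed computational basis; let $\mathbf m=(n_x,n_y)$. The quantum-phase fidelity of two qubit states $\rho_1,\rho_2$ with $\mathbf m_1\neq0$ and $\mathbf m_2\neq 0$ is $f(\rho_1,\rho_2)=\dfrac{\mathbf m_1\cdot\mathbf m_2}{\|\mathbf m_1\|\,\|\mathbf m_2\|}$; if $\mathbf m_1=0$ or $\mathbf m_2=0$ it is undefined. For a two-qubit state $\rho$ and a unitary $U$ on $\mathbb{C}^2\otimes\mathbb{C}^2$, let $\rho'=U\rho U^\dagger$, $\rho_1'=\operatorname{tr}_2\rho'$, $\rho_2'=\operatorname{tr}_1\rho'$; the phase synchronization fidelity is $F(\rho,U)=f(\rho_1',\rho_2')$, undefined when $f(\rho_1',\rho_2')$ is undefined. Quantum-phase synchronization by $U$ is called perfect for a set $\mathcal A$ of initial states if $F(\rho,U)=1$ for all $\rho\in\mathcal A$ for which $F(\rho,U)$ is defined. *)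

theory Defs
  imports "HOL-Analysis.Analysis"
begin

text \<open>
  Operators on \<open>\<complex>\<^sup>2\<close> are matrices indexed by the two-element type \<open>2\<close> (the computational basis
  vectors have indices 1 and 2); operators on \<open>\<complex>\<^sup>2 \<otimes> \<complex>\<^sup>2\<close> are matrices indexed by pairs.
  An entry \<open>A $ i $ j\<close> is in row \<open>i\<close> and column \<open>j\<close>.
\<close>

type_synonym qubit_vec = "complex ^ 2"
type_synonym qubit_op = "complex ^ 2 ^ 2"
type_synonym two_qubit_op = "complex ^ (2 \<times> 2) ^ (2 \<times> 2)"

definition dagger :: "complex ^ 'n ^ 'm \<Rightarrow> complex ^ 'm ^ 'n" where
  "dagger A = (\<chi> i j. cnj (A $ j $ i))"

definition special_unitary :: "(complex ^ 'n ^ 'n) set" where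
  "special_unitary = {U. dagger U ** U = mat 1 \<and> U ** dagger U = mat 1 \<and> det U = 1}"

definition ket_bra :: "complex ^ 'n \<Rightarrow> complex ^ 'n ^ 'n" where
  "ket_bra \<psi> = (\<chi> i j. \<psi> $ i * cnj (\<psi> $ j))"

definition tensor_op :: "qubit_op \<Rightarrow> qubit_op \<Rightarrow> two_qubit_op" where
  "tensor_op A B = (\<chi> p q. A $ fst p $ fst q * B $ snd p $ snd q)"

text \<open>The subscript is the subsystem that is traced out.\<close>

definition partial_trace\<^sub>1 :: "two_qubit_op \<Rightarrow> qubit_op" where
  "partial_trace\<^sub>1 \<rho> = (\<chi> i j. \<Sum>k\<in>UNIV. \<rho> $ (k, i) $ (k, j))"

definition partial_trace\<^sub>2 :: "two_qubit_op \<Rightarrow> qubit_op" where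
  "partial_trace\<^sub>2 \<rho> = (\<chi> i j. \<Sum>k\<in>UNIV. \<rho> $ (i, k) $ (j, k))"

definition pauli_x :: qubit_op where
  "pauli_x = vector [vector [0, 1], vector [1, 0]]"

definition pauli_y :: qubit_op where
  "pauli_y = vector [vector [0, - \<i>], vector [\<i>, 0]]"

definition pauli_z :: qubit_op where
  "pauli_z = vector [vector [1, 0], vector [0, - 1]]"

text \<open>
  For a Hermitian \<open>\<rho>\<close> the traces below are real (lemma \<open>trace_mult_hermitian_real\<close>), so that
  \<open>Re\<close> only changes the type.
\<close>

definition bloch :: "qubit_op \<Rightarrow> real ^ 3" where
  "bloch \<rho> = vector [Re (trace (pauli_x ** \<rho>)), Re (trace (pauli_y ** \<rho>)), Re (trace (pauli_z ** \<rho>))]"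

lemma dagger_pauli:
  "dagger pauli_x = pauli_x" "dagger pauli_y = pauli_y" "dagger pauli_z = pauli_z"
  by (simp_all add: dagger_def pauli_x_def pauli_y_def pauli_z_def vec_eq_iff forall_2)

lemma trace_mult_hermitian_real:
  fixes A B :: "complex ^ 'n ^ 'n"
  assumes "dagger A = A" "dagger B = B"
  shows "trace (A ** B) \<in> \<real>"
proof -
  have A: "cnj (A $ i $ j) = A $ j $ i" and B: "cnj (B $ i $ j) = B $ j $ i" for i j
    using assms by (simp_all add: dagger_def vec_eq_iff)
  have "cnj (trace (A ** B)) = trace (B ** A)"
    by (simp add: trace_def matrix_matrix_mult_def A B mult.commute)
  then show ?thesis
    by (metis Reals_cnj_iff trace_mul_sym)
qed

definition bloch_xy :: "qubit_op \<Rightarrow> real ^ 2" where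
  "bloch_xy \<rho> = vector [bloch \<rho> $ 1, bloch \<rho> $ 2]"

text \<open>The value \<open>None\<close> means ``undefined''.\<close>

definition phase_fidelity :: "qubit_op \<Rightarrow> qubit_op \<Rightarrow> real option" where
  "phase_fidelity \<rho>\<^sub>1 \<rho>\<^sub>2 =
     (let m\<^sub>1 = bloch_xy \<rho>\<^sub>1; m\<^sub>2 = bloch_xy \<rho>\<^sub>2
      in if m\<^sub>1 = 0 \<or> m\<^sub>2 = 0 then None else Some (m\<^sub>1 \<bullet> m\<^sub>2 / (norm m\<^sub>1 * norm m\<^sub>2)))"

definition phase_sync_fidelity :: "two_qubit_op \<Rightarrow> two_qubit_op \<Rightarrow> real option" where
  "phase_sync_fidelity \<rho> U =
     (let \<rho>' = U ** \<rho> ** dagger U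
      in phase_fidelity (partial_trace\<^sub>2 \<rho>') (partial_trace\<^sub>1 \<rho>'))"

definition perfect_phase_sync :: "two_qubit_op \<Rightarrow> two_qubit_op set \<Rightarrow> bool" where
  "perfect_phase_sync U \<A> \<longleftrightarrow>
     (\<forall>\<rho>\<in>\<A>. phase_sync_fidelity \<rho> U \<noteq> None \<longrightarrow> phase_sync_fidelity \<rho> U = Some 1)"

definition pure_product_states :: "two_qubit_op set" where
  "pure_product_states =
     {tensor_op (ket_bra \<psi>\<^sub>1) (ket_bra \<psi>\<^sub>2) | \<psi>\<^sub>1 \<psi>\<^sub>2 :: qubit_vec. norm \<psi>\<^sub>1 = 1 \<and> norm \<psi>\<^sub>2 = 1}"

end

theory Submission
  imports Defs "HOL-Complex_Analysis.Conformal_Mappings"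
begin

text \<open>
  Write the off-diagonal entries of the two reduced states of \<open>|\<phi>\<rangle>\<langle>\<phi>|\<close> as \<open>z\<^sub>1\<close> and \<open>z\<^sub>2\<close>; perfect
  synchronization means \<open>z\<^sub>1 \<cdot> cnj z\<^sub>2 \<ge> 0\<close> for every \<open>\<phi> = U (x \<otimes> y)\<close>. Reality of this number is an identity
  between polynomials in \<open>(x, y)\<close> and their conjugates, so it polarizes to independent product vectors
  in bra and ket. Choosing the ket so that one factor vanishes shows that certain two-dimensional coordinate
  subspaces contain the image of no product vector other than multiples of \<open>|11\<rangle>\<close> or of \<open>|22\<rangle>\<close>.

  Product vectors are the zeros of the quadratic form \<open>det\<close>, so with \<open>w\<^sub>k = U\<^sup>\<dagger> |k\<rangle>\<close> and \<open>D\<close> the polar form of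
  \<open>det\<close> this reads: \<open>w\<^sub>1\<^sub>1\<close> and \<open>w\<^sub>2\<^sub>2\<close> are isotropic and \<open>D\<close>-orthogonal to \<open>w\<^sub>1\<^sub>2\<close> and \<open>w\<^sub>2\<^sub>1\<close>, which are not
  isotropic. Hence \<open>w\<^sub>1\<^sub>1 + w\<^sub>1\<^sub>2 + t w\<^sub>2\<^sub>1\<close> is a product vector for the two roots \<open>t\<close> of \<open>n + 2 m t + t\<^sup>2\<close>, where
  \<open>m = D w\<^sub>2\<^sub>1 w\<^sub>1\<^sub>2 / D w\<^sub>2\<^sub>1 w\<^sub>2\<^sub>1\<close> and \<open>n = D w\<^sub>1\<^sub>2 w\<^sub>1\<^sub>2 / D w\<^sub>2\<^sub>1 w\<^sub>2\<^sub>1\<close>, and synchronization forces both roots to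
  be nonnegative. So \<open>m \<le> 0\<close> and \<open>n > 0\<close>, whereas unitarity of the matrix \<open>D w\<^sub>i w\<^sub>j\<close> gives
  \<open>m \<cdot> cnj n + cnj m = 0\<close>; thus \<open>m = 0\<close>, both roots vanish, and \<open>n = 0\<close>, a contradiction.
\<close>

section \<open>Product vectors and sesquilinear coherences\<close>

definition kron_vec :: "qubit_vec \<Rightarrow> qubit_vec \<Rightarrow> complex ^ (2 \<times> 2)" where
  "kron_vec x y = (\<chi> p. x $ fst p * y $ snd p)"

text \<open>The off-diagonal entry left after tracing the second qubit out of the operator with ket
  \<open>\<phi>\<close> and bra \<open>\<phi>'\<close>. Bra and ket are separate arguments so that
  they can be polarized.\<close>

definition coherence\<^sub>1 :: "complex ^ (2 \<times> 2) \<Rightarrow> complex ^ (2 \<times> 2) \<Rightarrow> complex" where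
  "coherence\<^sub>1 \<phi>' \<phi> = \<phi> $ (1, 1) * cnj (\<phi>' $ (2, 1)) + \<phi> $ (1, 2) * cnj (\<phi>' $ (2, 2))"

definition coherence\<^sub>2 :: "complex ^ (2 \<times> 2) \<Rightarrow> complex ^ (2 \<times> 2) \<Rightarrow> complex" where
  "coherence\<^sub>2 \<phi>' \<phi> = \<phi> $ (1, 1) * cnj (\<phi>' $ (1, 2)) + \<phi> $ (2, 1) * cnj (\<phi>' $ (2, 2))"

text \<open>The polarization of \<open>det\<close>, a vector being read as a \<open>2 \<times> 2\<close> matrix: \<open>det_form v v = 2 det v\<close>.\<close>

definition det_form :: "complex ^ (2 \<times> 2) \<Rightarrow> complex ^ (2 \<times> 2) \<Rightarrow> complex" where
  "det_form u v = u $ (1, 1) * v $ (2, 2) + u $ (2, 2) * v $ (1, 1)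
     - u $ (1, 2) * v $ (2, 1) - u $ (2, 1) * v $ (1, 2)"

lemma sum_pair_2: "(\<Sum>p\<in>(UNIV :: (2 \<times> 2) set). f p) = f (1, 1) + f (1, 2) + f (2, 1) + (f (2, 2) :: 'a :: comm_monoid_add)"
proof -
  have "(\<Sum>p\<in>(UNIV :: (2 \<times> 2) set). f p) = (\<Sum>i\<in>UNIV. \<Sum>j\<in>UNIV. f (i, j))"
    by (simp add: sum.cartesian_product UNIV_Times_UNIV)
  then show ?thesis by (simp add: sum_2 add.assoc)
qed

lemma vec_eq_pair_2:
  fixes u v :: "'a ^ (2 \<times> 2)"
  shows "u = v \<longleftrightarrow> u $ (1, 1) = v $ (1, 1) \<and> u $ (1, 2) = v $ (1, 2) \<and> u $ (2, 1) = v $ (2, 1) \<and> u $ (2, 2) = v $ (2, 2)"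
  by (simp add: vec_eq_iff forall_2)

section \<open>Synchronization as nonnegativity of a product of coherences\<close>

lemma conjugate_tensor_ket_bra:
  "U ** tensor_op (ket_bra x) (ket_bra y) ** dagger U = ket_bra (U *v kron_vec x y)"
proof -
  have "tensor_op (ket_bra x) (ket_bra y) = ket_bra (kron_vec x y)"
    by (simp add: tensor_op_def ket_bra_def kron_vec_def vec_eq_iff)
  moreover have "U ** ket_bra v ** dagger U = ket_bra (U *v v)" for v
    by (simp add: vec_eq_iff ket_bra_def matrix_matrix_mult_def matrix_vector_mult_def dagger_def
        sum_distrib_left sum_distrib_right mult_ac)
  ultimately show ?thesis by simp
qed

lemma bloch_xy_hermitian:
  assumes "\<rho> $ 2 $ 1 = cnj (\<rho> $ 1 $ 2)"
  shows "bloch_xy \<rho> = vector [2 * Re (\<rho> $ 1 $ 2), - 2 * Im (\<rho> $ 1 $ 2)]"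
  using assms
  by (simp add: bloch_xy_def bloch_def trace_def matrix_matrix_mult_def pauli_x_def pauli_y_def
      sum_2 vec_eq_iff forall_2)

lemma bloch_xy_partial_trace_ket_bra:
  "bloch_xy (partial_trace\<^sub>2 (ket_bra \<phi>)) = vector [2 * Re (coherence\<^sub>1 \<phi> \<phi>), - 2 * Im (coherence\<^sub>1 \<phi> \<phi>)]"
  "bloch_xy (partial_trace\<^sub>1 (ket_bra \<phi>)) = vector [2 * Re (coherence\<^sub>2 \<phi> \<phi>), - 2 * Im (coherence\<^sub>2 \<phi> \<phi>)]"
  by (subst bloch_xy_hermitian;
      simp add: partial_trace\<^sub>1_def partial_trace\<^sub>2_def ket_bra_def sum_2 coherence\<^sub>1_def coherence\<^sub>2_def mult.commute)+

lemma norm_vector_Re_Im: "norm (vector [2 * Re z, - 2 * Im z] :: real ^ 2) = 2 * norm z"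
proof -
  have "(2 * Re z)\<^sup>2 + (- 2 * Im z)\<^sup>2 = 2\<^sup>2 * ((Re z)\<^sup>2 + (Im z)\<^sup>2)"
    by (simp add: power2_eq_square algebra_simps)
  moreover have "norm (vector [a, b] :: real ^ 2) = sqrt (a\<^sup>2 + b\<^sup>2)" for a b
    by (simp add: norm_vec_def L2_set_def sum_2)
  ultimately show ?thesis
    by (simp only: cmod_def real_sqrt_mult) simp
qed

lemma nonneg_Reals_if_Re_eq_norm: "Re z = norm z \<Longrightarrow> z \<in> \<real>\<^sub>\<ge>\<^sub>0"
  by (metis complex_nonneg_Reals_iff norm_ge_zero cmod_eq_Re cmod_power2 add_cancel_right_right power_eq_0_iff zero_neq_numeral)

text \<open>Fidelity 1 is equality in Cauchy-Schwarz for the two planar Bloch vectors; in the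
  undefined case the product is 0.\<close>

lemma perfect_phase_sync_coherence_unit:
  assumes "perfect_phase_sync U pure_product_states" "norm x = 1" "norm y = 1"
  defines "\<phi> \<equiv> U *v kron_vec x y"
  shows "coherence\<^sub>1 \<phi> \<phi> * cnj (coherence\<^sub>2 \<phi> \<phi>) \<in> \<real>\<^sub>\<ge>\<^sub>0"
proof -
  define z w where "z = coherence\<^sub>1 \<phi> \<phi>" and "w = coherence\<^sub>2 \<phi> \<phi>"
  define m n :: "real ^ 2" where "m = vector [2 * Re z, - 2 * Im z]" and "n = vector [2 * Re w, - 2 * Im w]"
  have m: "norm m = 2 * norm z" and n: "norm n = 2 * norm w"
    unfolding m_def n_def by (rule norm_vector_Re_Im)+
  have mn: "m \<bullet> n = 4 * Re (z * cnj w)"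
    by (simp add: m_def n_def inner_vec_def sum_2)
  let ?\<rho> = "tensor_op (ket_bra x) (ket_bra y)"
  have F: "phase_sync_fidelity ?\<rho> U = (if m = 0 \<or> n = 0 then None else Some (m \<bullet> n / (norm m * norm n)))"
    by (simp only: phase_sync_fidelity_def phase_fidelity_def conjugate_tensor_ket_bra Let_def
        bloch_xy_partial_trace_ket_bra \<phi>_def m_def n_def z_def w_def)
  have "?\<rho> \<in> pure_product_states"
    using assms unfolding pure_product_states_def by blast
  with assms(1) have *: "phase_sync_fidelity ?\<rho> U \<noteq> None \<Longrightarrow> phase_sync_fidelity ?\<rho> U = Some 1"
    unfolding perfect_phase_sync_def by blast
  show ?thesis
  proof (cases "z = 0 \<or> w = 0")
    case True
    then show ?thesis by (auto simp: z_def w_def)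
  next
    case False
    with m n have "m \<noteq> 0" "n \<noteq> 0" by auto
    with * F have "m \<bullet> n = norm m * norm n" by (simp add: field_simps)
    then have "Re (z * cnj w) = norm (z * cnj w)"
      unfolding mn m n by (simp add: norm_mult)
    then show ?thesis
      unfolding z_def w_def by (rule nonneg_Reals_if_Re_eq_norm)
  qed
qed

lemma kron_vec_scaleR: "kron_vec (a *\<^sub>R x) (b *\<^sub>R y) = (a * b) *\<^sub>R kron_vec x y"
  by (simp add: kron_vec_def vec_eq_iff)

lemma perfect_phase_sync_coherence:
  assumes "perfect_phase_sync U pure_product_states"
  defines "\<phi> \<equiv> \<lambda>x y. U *v kron_vec x y"
  shows "coherence\<^sub>1 (\<phi> x y) (\<phi> x y) * cnj (coherence\<^sub>2 (\<phi> x y) (\<phi> x y)) \<in> \<real>\<^sub>\<ge>\<^sub>0"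
proof (cases "x = 0 \<or> y = 0")
  case True
  then have "kron_vec x y = 0" by (auto simp: kron_vec_def vec_eq_iff)
  then show ?thesis by (simp add: \<phi>_def coherence\<^sub>1_def)
next
  case False
  define x' y' r where "x' = (1 / norm x) *\<^sub>R x" and "y' = (1 / norm y) *\<^sub>R y" and "r = norm x * norm y"
  have unit: "norm x' = 1" "norm y' = 1" and xy: "x = norm x *\<^sub>R x'" "y = norm y *\<^sub>R y'"
    using False by (auto simp: x'_def y'_def)
  have "kron_vec x y = r *\<^sub>R kron_vec x' y'"
    by (subst xy(1), subst xy(2)) (simp add: kron_vec_scaleR r_def)
  then have "kron_vec x y $ k = of_real r * kron_vec x' y' $ k" for k
    by (simp only: vector_scaleR_component) (simp add: scaleR_conv_of_real)
  then have "\<phi> x y $ k = of_real r * \<phi> x' y' $ k" for k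
    by (simp add: \<phi>_def matrix_vector_mult_def sum_distrib_left mult_ac)
  then have "coherence\<^sub>1 (\<phi> x y) (\<phi> x y) * cnj (coherence\<^sub>2 (\<phi> x y) (\<phi> x y))
      = of_real (r ^ 4) * (coherence\<^sub>1 (\<phi> x' y') (\<phi> x' y') * cnj (coherence\<^sub>2 (\<phi> x' y') (\<phi> x' y')))"
    by (simp add: coherence\<^sub>1_def coherence\<^sub>2_def algebra_simps power4_eq_xxxx)
  moreover have "complex_of_real (r ^ 4) \<in> \<real>\<^sub>\<ge>\<^sub>0" by (simp only: nonneg_Reals_of_real_iff) simp
  ultimately show ?thesis
    using perfect_phase_sync_coherence_unit[OF assms(1) unit] by (simp only: \<phi>_def nonneg_Reals_mult_I)
qed

section \<open>Polarization by analytic continuation\<close>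

lemma holomorphic_zero_on_Reals:
  assumes "f holomorphic_on UNIV" "\<And>t :: real. f (of_real t) = 0"
  shows "f z = 0"
proof (rule analytic_continuation[of f UNIV \<real> 0])
  show "0 islimpt (\<real> :: complex set)"
    unfolding islimpt_approachable
  proof (intro allI impI)
    fix e :: real assume "e > 0"
    then show "\<exists>x'\<in>\<real>. x' \<noteq> (0::complex) \<and> dist x' 0 < e"
      by (intro bexI[of _ "of_real (e / 2)"]) auto
  qed
qed (use assms in \<open>auto elim: Reals_cases\<close>)

text \<open>On \<open>w = cnj z\<close> the coordinates \<open>s\<close>, \<open>t\<close> with
  \<open>z = s + \<i> * t\<close> and \<open>w = s - \<i> * t\<close> are real; they are made
  complex one at a time. Stating \<open>hol\<close> through entire substitutions keeps everything in
  one variable.\<close>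

lemma polarize_holomorphic:
  assumes hol: "\<And>f g. f holomorphic_on UNIV \<Longrightarrow> g holomorphic_on UNIV \<Longrightarrow>
      (\<lambda>s. h (f s) (g s)) holomorphic_on UNIV"
    and diag: "\<And>z. h z (cnj z) = 0"
  shows "h z w = 0"
proof -
  have "h (of_real s + \<i> * of_real t) (of_real s - \<i> * of_real t) = 0" for s t :: real
    using diag[of "Complex s t"] by (simp add: Complex_eq)
  then have "h (s + \<i> * of_real t) (s - \<i> * of_real t) = 0" for s :: complex and t :: real
    by (rule holomorphic_zero_on_Reals[where f = "\<lambda>s. h (s + \<i> * of_real t) (s - \<i> * of_real t)", rotated])
      (intro hol holomorphic_intros)
  then have "h (s + \<i> * t) (s - \<i> * t) = 0" for s t :: complex
    by (rule holomorphic_zero_on_Reals[where f = "\<lambda>t. h (s + \<i> * t) (s - \<i> * t)", rotated])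
      (intro hol holomorphic_intros)
  from this[of "(z + w) / 2" "(z - w) / (2 * \<i>)"] show ?thesis
    by (simp add: field_simps)
qed

lemma kron_vec_affine:
  "kron_vec (x + z *s u) (y + z *s v)
     = kron_vec x y + z *s (kron_vec u y + kron_vec x v) + z\<^sup>2 *s kron_vec u v"
  by (simp add: kron_vec_def vec_eq_iff algebra_simps power2_eq_square)

lemma coherence_polarized:
  fixes U :: two_qubit_op and x y x' y' :: qubit_vec
  assumes "\<And>x y. coherence\<^sub>1 (U *v kron_vec x y) (U *v kron_vec x y)
      * cnj (coherence\<^sub>2 (U *v kron_vec x y) (U *v kron_vec x y)) \<in> \<real>"
  defines "\<phi> \<equiv> U *v kron_vec x y" and "\<phi>' \<equiv> U *v kron_vec x' y'"
  shows "coherence\<^sub>1 \<phi>' \<phi> * cnj (coherence\<^sub>2 \<phi> \<phi>') = cnj (coherence\<^sub>1 \<phi> \<phi>') * coherence\<^sub>2 \<phi>' \<phi>"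
proof -
  define P where "P z = U *v kron_vec (x + z *s (x' - x)) (y + z *s (y' - y))" for z
  define c where "c = U *v kron_vec x y"
  define d where "d = U *v (kron_vec (x' - x) y + kron_vec x (y' - y))"
  define e where "e = U *v kron_vec (x' - x) (y' - y)"
  have P: "P z = c + z *s d + z\<^sup>2 *s e" for z
    unfolding P_def kron_vec_affine c_def d_def e_def
    by (simp only: matrix_vector_right_distrib vector_scalar_commute)
  \<comment> \<open>Ket at \<open>z\<close>, bra at \<open>cnj w\<close>: all four functions are
    polynomials in \<open>z\<close> and \<open>w\<close>, reality is the case
    \<open>w = cnj z\<close>, and \<open>z = 0\<close>, \<open>w = 1\<close> puts ket and bra at
    opposite ends of the path \<open>P\<close>.\<close>
  define C D where "C z w = coherence\<^sub>1 (P (cnj w)) (P z)" and "D z w = coherence\<^sub>2 (P (cnj w)) (P z)" for z w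
  define C' D' where "C' z w = cnj (coherence\<^sub>1 (P z) (P (cnj w)))"
    and "D' z w = cnj (coherence\<^sub>2 (P z) (P (cnj w)))" for z w
  have "C 0 1 * D' 0 1 - C' 0 1 * D 0 1 = 0"
  proof (rule polarize_holomorphic[where h = "\<lambda>z w. C z w * D' z w - C' z w * D z w"])
    show "(\<lambda>s. C (f s) (g s) * D' (f s) (g s) - C' (f s) (g s) * D (f s) (g s)) holomorphic_on UNIV"
      if [holomorphic_intros]: "f holomorphic_on UNIV" "g holomorphic_on UNIV" for f g
      unfolding C_def D_def C'_def D'_def coherence\<^sub>1_def coherence\<^sub>2_def P
      by (simp, intro holomorphic_intros)
    show "C z (cnj z) * D' z (cnj z) - C' z (cnj z) * D z (cnj z) = 0" for z
    proof -
      have "C z (cnj z) * D' z (cnj z) \<in> \<real>"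
        unfolding C_def D'_def P_def complex_cnj_cnj by (rule assms)
      then have "cnj (C z (cnj z) * D' z (cnj z)) = C z (cnj z) * D' z (cnj z)"
        by (simp only: Reals_cnj_iff)
      then show ?thesis by (simp add: C_def D_def C'_def D'_def)
    qed
  qed
  moreover have "P 0 = \<phi>" "P 1 = \<phi>'" by (simp_all add: P_def \<phi>_def \<phi>'_def)
  ultimately show ?thesis by (simp add: C_def D_def C'_def D'_def)
qed

section \<open>Pairs of additive maps on product vectors\<close>

text \<open>A group is not the union of two proper subgroups, here the kernels.\<close>

lemma additive_or:
  fixes l m :: "'a :: ab_group_add \<Rightarrow> 'b :: ab_group_add"
  assumes "\<And>u v. l (u + v) = l u + l v" "\<And>u v. m (u + v) = m u + m v"
    and "\<And>v. l v = 0 \<or> m v = 0"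
  shows "(\<forall>v. l v = 0) \<or> (\<forall>v. m v = 0)"
  by (metis assms add.right_neutral add.left_neutral)

lemma additive_eq_0_if_kron:
  assumes "\<And>u v. l (u + v) = l u + (l v :: complex)" "\<And>x y. l (kron_vec x y) = 0"
  shows "l v = 0"
proof -
  have "v = kron_vec (axis 1 1) (\<chi> j. v $ (1, j)) + kron_vec (axis 2 1) (\<chi> j. v $ (2, j))"
    by (simp add: vec_eq_pair_2 kron_vec_def axis_def)
  then show ?thesis using assms by (metis add.right_neutral)
qed

lemma additive_or_kron:
  fixes l m :: "complex ^ (2 \<times> 2) \<Rightarrow> complex"
  assumes l: "\<And>u v. l (u + v) = l u + l v" and m: "\<And>u v. m (u + v) = m u + m v"
    and "\<And>x y. l (kron_vec x y) = 0 \<or> m (kron_vec x y) = 0"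
  shows "(\<forall>v. l v = 0) \<or> (\<forall>v. m v = 0)"
proof -
  have kr: "kron_vec (x + x') y = kron_vec x y + kron_vec x' y"
    "kron_vec x (y + y') = kron_vec x y + kron_vec x y'" for x x' y y'
    by (simp_all add: kron_vec_def vec_eq_iff algebra_simps)
  have "(\<forall>y. l (kron_vec x y) = 0) \<or> (\<forall>y. m (kron_vec x y) = 0)" for x
    by (rule additive_or) (simp_all add: kr l m assms)
  then have "(\<lambda>y. l (kron_vec x y)) = (\<lambda>_. 0) \<or> (\<lambda>y. m (kron_vec x y)) = (\<lambda>_. 0)" for x
    by (simp add: fun_eq_iff)
  \<comment> \<open>The same covering argument, now for the maps sending \<open>x\<close> to a
    function of \<open>y\<close>.\<close>
  then have "(\<forall>x. (\<forall>y. l (kron_vec x y) = 0)) \<or> (\<forall>x. (\<forall>y. m (kron_vec x y) = 0))"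
    by (metis kr(1) l m add.right_neutral add.left_neutral)
  then show ?thesis
    using additive_eq_0_if_kron[of l] additive_eq_0_if_kron[of m] l m by blast
qed

text \<open>One of the two antilinear factors must vanish on the whole space, and by surjectivity of
  \<open>U\<close> it can be tested at a basis vector, where its value is \<open>c\<close>.\<close>

lemma kron_image_product_zero:
  assumes "U ** W = mat 1" "i \<noteq> j"
    and "\<And>x y. let \<phi> = U *v kron_vec x y in (c * cnj (\<phi> $ i) + d * cnj (\<phi> $ j)) * (c * cnj (\<phi> $ k)) = 0"
  shows "c = 0"
proof (rule ccontr)
  assume c: "c \<noteq> 0"
  define l m where "l v = c * cnj ((U *v v) $ i) + d * cnj ((U *v v) $ j)" and "m v = c * cnj ((U *v v) $ k)" for v
  have "(\<forall>v. l v = 0) \<or> (\<forall>v. m v = 0)"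
    by (rule additive_or_kron)
      (use assms(3) in \<open>simp_all add: l_def m_def Let_def matrix_vector_right_distrib distrib_left add_ac\<close>)
  moreover have "U *v (W *v v) = v" for v
    by (simp add: matrix_vector_mul_assoc assms)
  then have "l (W *v axis i 1) = c" "m (W *v axis k 1) = c"
    using assms(2) by (simp_all add: l_def m_def axis_def)
  ultimately show False using c by metis
qed

section \<open>Product vectors as zeros of a quadratic form\<close>

lemma kron_vec_if_det_form_zero:
  assumes "det_form v v = 0"
  obtains x y where "v = kron_vec x y"
proof -
  have d: "v $ (1, 1) * v $ (2, 2) = v $ (1, 2) * v $ (2, 1)"
    using assms by (simp add: det_form_def algebra_simps)
  show ?thesis
  proof (cases "v $ (1, 1) = 0 \<and> v $ (1, 2) = 0")
    case True
    show ?thesis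
      by (rule that[of "axis 2 1" "\<chi> j. v $ (2, j)"])
        (use True in \<open>simp add: vec_eq_pair_2 kron_vec_def axis_def\<close>)
  next
    case False
    then obtain j where j: "v $ (1, j) \<noteq> 0" by blast
    have d': "v $ (1, j) * v $ (2, k) = v $ (1, k) * v $ (2, j)" for j k
      using d exhaust_2[of j] exhaust_2[of k] by (auto simp: mult.commute)
    \<comment> \<open>Rank-one factorization around the pivot \<open>(1, j)\<close>: column
      \<open>j\<close> divided by the pivot, times the first row.\<close>
    show ?thesis
      by (rule that[of "\<chi> i. v $ (i, j) / v $ (1, j)" "\<chi> k. v $ (1, k)"])
        (use j d'[of j] in \<open>simp add: vec_eq_pair_2 kron_vec_def field_simps\<close>)
  qed
qed

lemma complex_quadratic_root:
  fixes a b c :: complex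
  assumes "a \<noteq> 0 \<or> b \<noteq> 0"
  obtains s where "c + 2 * s * b + s\<^sup>2 * a = 0"
proof (cases "a = 0")
  case True
  with assms show ?thesis by (intro that[of "- c / (2 * b)"]) auto
next
  case False
  define t where "t = csqrt (b\<^sup>2 - a * c)"
  have t: "t * t = b * b - a * c" using power2_csqrt[of "b\<^sup>2 - a * c"] by (simp add: t_def power2_eq_square)
  show ?thesis
  proof (rule that[of "(t - b) / a"])
    have "(c + 2 * ((t - b) / a) * b + ((t - b) / a)\<^sup>2 * a) * a = a * c + t * t - b * b"
      using False by (simp add: field_simps power2_eq_square)
    then show "c + 2 * ((t - b) / a) * b + ((t - b) / a)\<^sup>2 * a = 0"
      using False t by simp
  qed
qed

lemma det_form_add_scaled:
  "det_form (q + s *s a) (q + s *s a) = det_form q q + 2 * s * det_form q a + s\<^sup>2 * det_form a a"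
  by (simp add: det_form_def algebra_simps power2_eq_square)

lemma det_form_commute: "det_form u v = det_form v u"
  by (simp add: det_form_def)

section \<open>Unitarity and the determinant form\<close>

lemma parseval_coisometry:
  fixes W :: "complex ^ 'n ^ 'm"
  assumes "W ** dagger W = mat 1"
  shows "(\<Sum>k\<in>UNIV. (\<Sum>i\<in>UNIV. g i * W $ i $ k) * cnj (\<Sum>j\<in>UNIV. h j * W $ j $ k)) = (\<Sum>i\<in>UNIV. g i * cnj (h i))"
proof -
  have W: "(\<Sum>k\<in>UNIV. W $ i $ k * cnj (W $ j $ k)) = (if i = j then 1 else 0)" for i j
    using arg_cong[OF assms, of "\<lambda>M. M $ i $ j"] by (simp add: matrix_matrix_mult_def dagger_def mat_def)
  have "(\<Sum>k\<in>UNIV. (\<Sum>i\<in>UNIV. g i * W $ i $ k) * cnj (\<Sum>j\<in>UNIV. h j * W $ j $ k))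
      = (\<Sum>k\<in>UNIV. \<Sum>i\<in>UNIV. \<Sum>j\<in>UNIV. g i * cnj (h j) * (W $ i $ k * cnj (W $ j $ k)))"
    by (simp add: sum_product mult_ac)
  also have "\<dots> = (\<Sum>i\<in>UNIV. \<Sum>j\<in>UNIV. g i * cnj (h j) * (\<Sum>k\<in>UNIV. W $ i $ k * cnj (W $ j $ k)))"
    by (subst sum.swap, rule sum.cong[OF refl], subst sum.swap) (simp add: sum_distrib_left)
  also have "\<dots> = (\<Sum>i\<in>UNIV. g i * cnj (h i))"
    by (simp add: W if_distrib cong: if_cong)
  finally show ?thesis .
qed

lemma det_form_orthogonal:
  fixes W :: two_qubit_op
  assumes W: "W ** dagger W = mat 1" and uv: "(\<Sum>p\<in>UNIV. u $ p * cnj (v $ p)) = 0"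
  shows "(\<Sum>k\<in>UNIV. det_form u (column k W) * cnj (det_form v (column k W))) = 0"
proof -
  \<comment> \<open>\<open>J\<close> is the spin flip: \<open>D w\<close> is the functional with coefficients \<open>J w\<close>, and \<open>J\<close> is a signed permutation.\<close>
  define J where "J w = (\<lambda>p :: 2 \<times> 2. if p = (1, 1) then w $ (2, 2) else if p = (2, 2) then w $ (1, 1)
    else if p = (1, 2) then - (w $ (2, 1)) else - (w $ (1, 2)))" for w :: "complex ^ (2 \<times> 2)"
  have D: "det_form w (column k W) = (\<Sum>p\<in>UNIV. J w p * W $ p $ k)" for w k
    by (simp add: sum_pair_2 J_def det_form_def column_def)
  have "(\<Sum>p\<in>UNIV. J u p * cnj (J v p)) = (\<Sum>p\<in>UNIV. u $ p * cnj (v $ p))"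
    by (simp add: sum_pair_2 J_def)
  then show ?thesis
    unfolding D parseval_coisometry[OF W] using uv by simp
qed

section \<open>The values of \<open>det_form\<close> on the columns \<open>w\<close> and the
  resulting quadratic\<close>

theorem theorem1:
  shows "\<not> (\<exists>U \<in> special_unitary. perfect_phase_sync U pure_product_states)"
proof
  assume "\<exists>U \<in> special_unitary. perfect_phase_sync U pure_product_states"
  then obtain U where U: "U \<in> special_unitary" and perfect: "perfect_phase_sync U pure_product_states"
    by blast
  define W where "W = dagger U"
  have dagger_W: "dagger W = U" by (simp add: W_def dagger_def vec_eq_iff)
  have UW: "U ** W = mat 1" and WU: "W ** dagger W = mat 1"
    using U unfolding dagger_W unfolding W_def special_unitary_def by auto
  define w where "w k = column k W" for k
  have "(U *v w k) $ i = (U ** W) $ i $ k" for i k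
    by (simp add: matrix_vector_mult_def matrix_matrix_mult_def w_def column_def)
  then have Uw: "U *v w k = axis k 1" for k
    unfolding vec_eq_iff UW mat_def axis_def by simp
  have pos: "coherence\<^sub>1 (U *v kron_vec x y) (U *v kron_vec x y)
      * cnj (coherence\<^sub>2 (U *v kron_vec x y) (U *v kron_vec x y)) \<in> \<real>\<^sub>\<ge>\<^sub>0" for x y
    by (rule perfect_phase_sync_coherence[OF perfect])
  then have "coherence\<^sub>1 (U *v kron_vec x y) (U *v kron_vec x y)
      * cnj (coherence\<^sub>2 (U *v kron_vec x y) (U *v kron_vec x y)) \<in> \<real>" for x y
    using nonneg_Reals_subset_Reals by blast
  note polar = coherence_polarized[OF this]
  note zero = kron_image_product_zero[OF UW, unfolded Let_def]

  \<comment> \<open>Two vanishing coordinates of the ket kill one side of the polarized identity and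
    turn the other into a product of two antilinear forms in an arbitrary bra.\<close>
  have forbidden: "\<phi> $ (1, 1) = 0 \<Longrightarrow> \<phi> $ (1, 2) = 0 \<Longrightarrow> \<phi> $ (2, 1) = 0"
    "\<phi> $ (2, 1) = 0 \<Longrightarrow> \<phi> $ (2, 2) = 0 \<Longrightarrow> \<phi> $ (1, 2) = 0"
    "\<phi> $ (1, 1) = 0 \<Longrightarrow> \<phi> $ (2, 1) = 0 \<Longrightarrow> \<phi> $ (1, 2) = 0"
    "\<phi> $ (1, 2) = 0 \<Longrightarrow> \<phi> $ (2, 2) = 0 \<Longrightarrow> \<phi> $ (2, 1) = 0"
    if "\<phi> = U *v kron_vec x y" for \<phi> x y
  proof -
    have polar': "(\<phi> $ (2, 1) * cnj (\<phi>' $ (1, 1)) + \<phi> $ (2, 2) * cnj (\<phi>' $ (1, 2)))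
          * (\<phi> $ (1, 1) * cnj (\<phi>' $ (1, 2)) + \<phi> $ (2, 1) * cnj (\<phi>' $ (2, 2)))
        = (\<phi> $ (1, 1) * cnj (\<phi>' $ (2, 1)) + \<phi> $ (1, 2) * cnj (\<phi>' $ (2, 2)))
          * (\<phi> $ (1, 2) * cnj (\<phi>' $ (1, 1)) + \<phi> $ (2, 2) * cnj (\<phi>' $ (2, 1)))"
      if "\<phi>' = U *v kron_vec x' y'" for \<phi>' x' y'
      using polar[of x' y' x y, symmetric]
      unfolding \<open>\<phi> = U *v kron_vec x y\<close>[symmetric] that[symmetric] coherence\<^sub>1_def coherence\<^sub>2_def
        complex_cnj_add complex_cnj_mult complex_cnj_cnj
      by (simp only: mult.commute)
    show "\<phi> $ (2, 1) = 0" if "\<phi> $ (1, 1) = 0" "\<phi> $ (1, 2) = 0"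
      by (rule zero[of "(1, 1)" "(1, 2)" _ "\<phi> $ (2, 2)" "(2, 2)"])
        (use polar'[OF refl] that in \<open>auto simp: add.commute\<close>)
    show "\<phi> $ (1, 2) = 0" if "\<phi> $ (2, 1) = 0" "\<phi> $ (2, 2) = 0"
      by (rule zero[of "(2, 2)" "(2, 1)" _ "\<phi> $ (1, 1)" "(1, 1)"])
        (use polar'[OF refl] that in \<open>auto simp: add.commute\<close>)
    show "\<phi> $ (1, 2) = 0" if "\<phi> $ (1, 1) = 0" "\<phi> $ (2, 1) = 0"
      by (rule zero[of "(1, 1)" "(2, 1)" _ "\<phi> $ (2, 2)" "(2, 2)"])
        (use polar'[OF refl] that in \<open>auto simp: add.commute\<close>)
    show "\<phi> $ (2, 1) = 0" if "\<phi> $ (1, 2) = 0" "\<phi> $ (2, 2) = 0"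
      by (rule zero[of "(2, 2)" "(1, 2)" _ "\<phi> $ (1, 1)" "(1, 1)"])
        (use polar'[OF refl] that in \<open>auto simp: add.commute\<close>)
  qed

  \<comment> \<open>\<open>U\<close> sends \<open>w q + s *s w a\<close> to a vector excluded by
    \<open>forbidden\<close>, so a quadratic in \<open>s\<close> has no complex root and must be a
    nonzero constant.\<close>
  have D: "det_form (w q) (w a) = 0 \<and> det_form (w a) (w a) = 0 \<and> det_form (w q) (w q) \<noteq> 0"
    if qa: "(q, a) \<in> {((2, 1), (2, 2)), ((2, 1), (1, 1)), ((1, 2), (2, 2)), ((1, 2), (1, 1))}" for q a
  proof -
    have no_root: "det_form (w q + s *s w a) (w q + s *s w a) \<noteq> 0" for s
    proof
      assume "det_form (w q + s *s w a) (w q + s *s w a) = 0"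
      then obtain x y where "w q + s *s w a = kron_vec x y" by (rule kron_vec_if_det_form_zero)
      then have "U *v (w q + s *s w a) = U *v kron_vec x y" by simp
      then have "axis q 1 + s *s axis a 1 = U *v kron_vec x y"
        by (simp only: matrix_vector_right_distrib vector_scalar_commute Uw)
      note no = forbidden[OF this]
      from qa consider "q = (2, 1) \<and> a = (2, 2)" | "q = (2, 1) \<and> a = (1, 1)"
        | "q = (1, 2) \<and> a = (2, 2)" | "q = (1, 2) \<and> a = (1, 1)"
        by blast
      then show False
      proof cases
        case 1 with no(1) show False by (simp add: axis_def)
      next
        case 2 with no(4) show False by (simp add: axis_def)
      next
        case 3 with no(3) show False by (simp add: axis_def)
      next
        case 4 with no(2) show False by (simp add: axis_def)
      qed
    qed
    then have "det_form (w q) (w a) = 0 \<and> det_form (w a) (w a) = 0"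
      using complex_quadratic_root[of "det_form (w a) (w a)" "det_form (w q) (w a)" "det_form (w q) (w q)"]
      unfolding det_form_add_scaled by metis
    then show ?thesis using no_root[of 0] by simp
  qed
  have Daa: "det_form (w (1, 1)) (w (1, 1)) = 0"
    using D[of "(2, 1)" "(1, 1)"] by simp

  define m n where "m = det_form (w (2, 1)) (w (1, 2)) / det_form (w (2, 1)) (w (2, 1))"
    and "n = det_form (w (1, 2)) (w (1, 2)) / det_form (w (2, 1)) (w (2, 1))"
  have "n \<noteq> 0" using D[of "(2,1)" "(1,1)"] D[of "(1,2)" "(1,1)"] by (simp add: n_def)
  have root: "t \<in> \<real>\<^sub>\<ge>\<^sub>0" if t: "n + 2 * t * m + t\<^sup>2 = 0" for t
  proof -
    define v where "v = w (1, 1) + w (1, 2) + t *s w (2, 1)"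
    have "(n + 2 * t * m + t\<^sup>2) * det_form (w (2, 1)) (w (2, 1))
        = det_form (w (1, 2)) (w (1, 2)) + 2 * t * det_form (w (2, 1)) (w (1, 2)) + t\<^sup>2 * det_form (w (2, 1)) (w (2, 1))"
      using D[of "(2,1)" "(1,1)"] by (simp add: m_def n_def field_simps)
    moreover have "det_form v v = det_form (w (1, 1)) (w (1, 1)) + 2 * det_form (w (1, 2)) (w (1, 1))
         + 2 * t * det_form (w (2, 1)) (w (1, 1)) + det_form (w (1, 2)) (w (1, 2))
         + 2 * t * det_form (w (2, 1)) (w (1, 2)) + t\<^sup>2 * det_form (w (2, 1)) (w (2, 1))"
      by (simp add: v_def det_form_def algebra_simps power2_eq_square)
    ultimately have "det_form v v = 0"
      using D[of "(2,1)" "(1,1)"] D[of "(1,2)" "(1,1)"] Daa t by simp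
    then obtain x y where "v = kron_vec x y" by (rule kron_vec_if_det_form_zero)
    moreover have "U *v v = axis (1, 1) 1 + axis (1, 2) 1 + t *s axis (2, 1) 1"
      by (simp add: v_def matrix_vector_right_distrib vector_scalar_commute Uw)
    \<comment> \<open>Here \<open>coherence\<^sub>1\<close> equals \<open>cnj t\<close> and
      \<open>coherence\<^sub>2\<close> equals 1.\<close>
    ultimately have "cnj t \<in> \<real>\<^sub>\<ge>\<^sub>0"
      using pos[of x y] by (simp add: coherence\<^sub>1_def coherence\<^sub>2_def axis_def)
    then show ?thesis by (simp add: complex_nonneg_Reals_iff)
  qed
  obtain t where t: "n + 2 * t * m + t\<^sup>2 = 0"
    using complex_quadratic_root[of 1 m n] by auto
  \<comment> \<open>The other root, by Vieta; it may coincide with \<open>t\<close>.\<close>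
  define t' where "t' = - 2 * m - t"
  have "n + 2 * t' * m + t'\<^sup>2 = n + 2 * t * m + t\<^sup>2"
    by (simp add: t'_def algebra_simps power2_eq_square)
  with t have t': "n + 2 * t' * m + t'\<^sup>2 = 0" by simp
  have "n - t * t' = n + 2 * t * m + t\<^sup>2"
    by (simp add: t'_def algebra_simps power2_eq_square)
  with t have n: "n = t * t'" by simp
  obtain r r' where r: "t = of_real r" "t' = of_real r'" "r \<ge> 0" "r' \<ge> 0"
    using root[OF t] root[OF t'] by (auto elim!: nonneg_Reals_cases)
  have "m = - (t + t') / 2" by (simp add: t'_def)
  with r have m: "m = of_real (- (r + r') / 2)" by simp
  have n': "n = of_real (r * r')" using n r by simp

  have "(\<Sum>p\<in>UNIV. w (2, 1) $ p * cnj (w (1, 2) $ p)) = 0"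
  proof -
    have "(U *v w (2, 1)) $ (1, 2) = (\<Sum>p\<in>UNIV. w (2, 1) $ p * cnj (w (1, 2) $ p))"
      by (simp add: matrix_vector_mult_def w_def column_def W_def dagger_def mult.commute)
    then show ?thesis by (simp add: Uw axis_def)
  qed
  \<comment> \<open>Two rows of the matrix of values \<open>det_form (w i) (w j)\<close> are
    orthogonal; by \<open>D\<close> only the columns \<open>(1, 2)\<close> and \<open>(2, 1)\<close>
    contribute.\<close>
  from det_form_orthogonal[OF WU this, folded w_def]
  have "det_form (w (2, 1)) (w (1, 2)) * cnj (det_form (w (1, 2)) (w (1, 2)))
      + det_form (w (2, 1)) (w (2, 1)) * cnj (det_form (w (2, 1)) (w (1, 2))) = 0"
    using D by (simp add: sum_pair_2 det_form_commute[of "w (1, 2)" "w (2, 1)"])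
  moreover have "det_form (w (2, 1)) (w (1, 2)) = m * det_form (w (2, 1)) (w (2, 1))"
    "det_form (w (1, 2)) (w (1, 2)) = n * det_form (w (2, 1)) (w (2, 1))"
    using D[of "(2,1)" "(1,1)"] by (simp_all add: m_def n_def)
  ultimately have "(m * cnj n + cnj m) * (det_form (w (2, 1)) (w (2, 1)) * cnj (det_form (w (2, 1)) (w (2, 1)))) = 0"
    by (simp add: algebra_simps)
  then have "m * cnj n + cnj m = 0" using D[of "(2,1)" "(1,1)"] by simp
  then have "of_real (- (r + r') / 2 * (r * r') + - (r + r') / 2) = (0 :: complex)"
    by (simp only: m n' complex_cnj_complex_of_real of_real_add of_real_mult complex_cnj_mult)
  then have "- (r + r') / 2 * (r * r') + - (r + r') / 2 = 0" by (simp only: of_real_eq_0_iff)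
  \<comment> \<open>The second factor is at least 1, so the nonnegative roots sum to 0.\<close>
  then have "(r + r') * (r * r' + 1) = 0" unfolding ring_distribs by (simp add: field_simps)
  moreover have "r * r' + 1 > 0" using r by (simp add: add_nonneg_pos)
  ultimately have "r + r' = 0" by simp
  with r have "r = 0" by simp
  with n' \<open>n \<noteq> 0\<close> show False by simp
qed

end
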